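(* For integers $d,l\ge2$ let $\beta_*=\beta_*(d,l)$ be the unique solution in $(0,1/d)$ of $(1-d\beta)^l=\beta(1-\beta)^{l-1}$. The condition $$G_{\beta_*}(s)>0\qquad\text{for all }0<s<\beta_*-c_0(\beta_* )$$ (with $G_\beta=G_{\beta,d,l}$ and $c_0(\beta)=c_0(\beta,l)$ as in the context) can hold for only finitely many pairs $(d,l)$ with $d,l\ge2$.
   Context: For integers $d,l\ge2$, $0<\beta<1/d$ and $0<s<\beta$, $$t_\beta(s):=\frac{(\beta-s)^{1/l}s^{1-2/l}}{(1-\beta-s)^{(l-1)/l}},$$ $$c_0(\beta):=\frac{3\beta l-2l+1+\sqrt{9\beta^2l^2-8\beta^2l-12\beta l^2+10\beta l+4l^2-4l+1}}{2l}$$ (this number lies in $(0,\beta)$), and $$\begin{aligned}G_\beta(s):={}&(1-(d-1)t_\beta(s))(d+l-dl)s^2+2\beta(1-\beta d)(1-\beta)\bigl(1-(d-1)(l-1)t_\beta(s)\bigr)\\&+s\Bigl[-t_\beta(s)(d-1)\bigl(\beta l-3\beta d-2l+2\beta^2d+3\beta dl-2\beta^2dl+1\bigr)\\&\qquad+2\beta^2d-\beta l-\beta d+\beta dl-1\Bigr].\end{aligned}$$ *)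

theory Defs
  imports "HOL-Analysis.Analysis"
begin

(* All functions below are meant for d, l >= 2, 0 < \<beta> < 1/d and 0 < s < \<beta>; since then
   \<beta> < 1/2, every base of a real power is positive. *)

definition t_beta :: "nat \<Rightarrow> real \<Rightarrow> real \<Rightarrow> real" where
  "t_beta l \<beta> s =
     (\<beta> - s) powr (1 / real l) * s powr (1 - 2 / real l)
       / (1 - \<beta> - s) powr ((real l - 1) / real l)"

definition c0 :: "nat \<Rightarrow> real \<Rightarrow> real" where
  "c0 n \<beta> = (let l = real n in
     (3 * \<beta> * l - 2 * l + 1
        + sqrt (9 * \<beta>^2 * l^2 - 8 * \<beta>^2 * l - 12 * \<beta> * l^2 + 10 * \<beta> * l + 4 * l^2 - 4 * l + 1))
     / (2 * l))"

(* The naturals m, n are the parameters d, l of the formula; d and l denote their real values,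
   so that d + l - d * l is not truncated. *)
definition G_beta :: "nat \<Rightarrow> nat \<Rightarrow> real \<Rightarrow> real \<Rightarrow> real" where
  "G_beta m n \<beta> s = (let d = real m; l = real n; t = t_beta n \<beta> s in
     (1 - (d - 1) * t) * (d + l - d * l) * s^2
     + 2 * \<beta> * (1 - \<beta> * d) * (1 - \<beta>) * (1 - (d - 1) * (l - 1) * t)
     + s * (- t * (d - 1) * (\<beta> * l - 3 * \<beta> * d - 2 * l + 2 * \<beta>^2 * d
                               + 3 * \<beta> * d * l - 2 * \<beta>^2 * d * l + 1)
            + 2 * \<beta>^2 * d - \<beta> * l - \<beta> * d + \<beta> * d * l - 1))"

definition is_beta_star :: "nat \<Rightarrow> nat \<Rightarrow> real \<Rightarrow> bool" where
  "is_beta_star d l \<beta> \<longleftrightarrow>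
     0 < \<beta> \<and> \<beta> < 1 / real d \<and> (1 - real d * \<beta>) ^ l = \<beta> * (1 - \<beta>) ^ (l - 1)"

definition beta_star :: "nat \<Rightarrow> nat \<Rightarrow> real" where
  "beta_star d l = (THE \<beta>. is_beta_star d l \<beta>)"

lemma is_beta_star_less_False:
  assumes "d \<ge> 2" "l \<ge> 2" and a: "is_beta_star d l a" and b: "is_beta_star d l b" and "a < b"
  shows False
proof -
  have d: "real d \<ge> 2" using assms(1) by simp
  have bd: "real d * b < 1" using b d unfolding is_beta_star_def by (simp add: field_simps)
  have a0: "0 < a" using a unfolding is_beta_star_def by simp
  have "2 * b \<le> real d * b" using d a0 \<open>a < b\<close> by (intro mult_right_mono) auto
  hence b1: "b < 1" using bd a0 \<open>a < b\<close> by linarith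
  have eq: "((1 - real d * x) / (1 - x)) ^ l = x / (1 - x)"
    if "is_beta_star d l x" "x < 1" for x
  proof -
    obtain k where k: "l = Suc k" using assms(2) by (cases l) auto
    have "(1 - real d * x) ^ l = x * (1 - x) ^ k"
      using that(1) k unfolding is_beta_star_def by simp
    moreover have "1 - x \<noteq> 0" using that(2) by simp
    ultimately show ?thesis using k by (simp add: power_divide)
  qed
  have "(1 - real d * b) * (1 - a) \<le> (1 - real d * a) * (1 - b)"
  proof -
    have "(1 - real d * a) * (1 - b) - (1 - real d * b) * (1 - a) = (real d - 1) * (b - a)"
      by (simp add: algebra_simps)
    thus ?thesis using d \<open>a < b\<close> by (smt (verit) mult_nonneg_nonneg)
  qed
  hence "(1 - real d * b) / (1 - b) \<le> (1 - real d * a) / (1 - a)"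
    using b1 \<open>a < b\<close> by (simp add: divide_simps)
  hence "((1 - real d * b) / (1 - b)) ^ l \<le> ((1 - real d * a) / (1 - a)) ^ l"
    using bd b1 by (intro power_mono) auto
  hence "b / (1 - b) \<le> a / (1 - a)"
    using eq[OF a] eq[OF b] b1 \<open>a < b\<close> by simp
  thus False using b1 \<open>a < b\<close> by (simp add: divide_simps algebra_simps)
qed

lemma ex1_beta_star:
  assumes "d \<ge> 2" "l \<ge> 2"
  shows "\<exists>!\<beta>. is_beta_star d l \<beta>"
proof -
  define f where "f x = x * (1 - x) ^ (l - 1) - (1 - real d * x) ^ l" for x :: real
  have d: "real d \<ge> 2" using assms(1) by simp
  have "(1 - 1 / real d) > 0" using d by (simp add: field_simps)
  hence f1: "f (1 / real d) > 0" using d assms(2) by (simp add: f_def power_0_left)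
  have f0: "f 0 < 0" by (simp add: f_def)
  have "\<exists>x\<ge>0. x \<le> 1 / real d \<and> f x = 0"
    using f0 f1 d by (intro IVT') (auto simp: f_def intro!: continuous_intros)
  then obtain x where x: "0 \<le> x" "x \<le> 1 / real d" "f x = 0" by blast
  have "x \<noteq> 0" "x \<noteq> 1 / real d" using x(3) f0 f1 by auto
  hence "is_beta_star d l x" using x by (auto simp: is_beta_star_def f_def)
  thus ?thesis
    using is_beta_star_less_False[OF assms] by (metis linorder_less_linear)
qed

lemma is_beta_star_beta_star:
  assumes "d \<ge> 2" "l \<ge> 2"
  shows "is_beta_star d l (beta_star d l)"
  unfolding beta_star_def by (rule theI'[OF ex1_beta_star[OF assms]])

end

(* Put u = (1 - d \<beta>) / (1 - \<beta>). The equation for \<beta> becomes u^l = \<beta> / (1 - \<beta>), hence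
   (d - 1) u^l = 1 - u, and T = (d - 1) t_\<beta>(x \<beta>) is at least
   (1 - x)^(1/l) x^(1 - 2/l) (1 - u) / u. In these terms G_\<beta>(x \<beta>) / \<beta> has main term
   (l - 1)(1 - x)(1 - \<beta>) ((1 - u) x - T (2 u (1 - \<beta>) + (1 - u) x)), which is negative, and a
   remainder of at most T x + 2 u + \<beta> x^2. With W = (l - 1)(1 - u) and x = 1/4 the main term wins
   if W is large, which happens for large l uniformly in d since u^l <= 1 - u forces
   l (1 - u) to infinity. For bounded l >= 3 and d to infinity, u tends to 0, so W tends to
   l - 1 >= 2 and T to infinity, and again the main term wins at x = 1/4. For l = 2 one takes
   x = u / 4 instead, where T u stays near 1 while the remainder is small. *)
theory Submission
  imports Defs "HOL-Real_Asymp.Real_Asymp"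
begin

section \<open>Rescaling \<open>s = x * \<beta>\<close> in \<open>G_beta\<close>,
  \<open>t_beta\<close> and \<open>c0\<close>\<close>

text \<open>A polynomial identity in which \<open>t_beta\<close> is a free variable. Collecting the
  factor \<open>l - 1\<close> isolates the term that decides the sign.\<close>

lemma G_beta_scaled:
  fixes \<beta> u x :: real
  assumes u: "1 - real d * \<beta> = u * (1 - \<beta>)"
    and T: "(real d - 1) * t_beta l \<beta> (x * \<beta>) = T"
  shows "G_beta d l \<beta> (x * \<beta>) = \<beta> *
     ((real l - 1) * (1 - x) * (1 - \<beta>) * ((1 - u) * x - T * (2 * u * (1 - \<beta>) + (1 - u) * x))
      + \<beta> * (1 - T) * x\<^sup>2 + 2 * u * (1 - \<beta>)\<^sup>2
      + x * (T * (1 - \<beta>) - 1 - \<beta> + 2 * \<beta> * (real d * \<beta>)))"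
proof -
  define D L t v where defs: "D = real d" "L = real l" "t = t_beta l \<beta> (x * \<beta>)" "v = 1 - D * \<beta>"
  have v: "v = u * (1 - \<beta>)" using u by (simp add: defs)
  have T: "(D - 1) * t = T" using T by (simp add: defs)
  have G: "G_beta d l \<beta> (x * \<beta>) = \<beta> *
     ((L - 1) * (1 - x) * ((1 - \<beta> - v) * x - T * (2 * v * (1 - \<beta>) + (1 - \<beta> - v) * x))
      + \<beta> * (1 - T) * x\<^sup>2 + 2 * v * (1 - \<beta>)
      + x * (T * (1 - \<beta>) - 1 - \<beta> + 2 * \<beta> * (D * \<beta>)))"
    unfolding G_beta_def Let_def defs(1-3)[symmetric] defs(4) T[symmetric]
    by algebra
  have "(1 - \<beta>) * ((1 - u) * x - T * (2 * u * (1 - \<beta>) + (1 - u) * x))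
      = (1 - \<beta> - v) * x - T * (2 * v * (1 - \<beta>) + (1 - \<beta> - v) * x)"
    "2 * u * (1 - \<beta>)\<^sup>2 = 2 * v * (1 - \<beta>)"
    unfolding v by algebra+
  then show ?thesis
    unfolding G defs(1,2)[symmetric] by (simp add: mult.assoc)
qed

text \<open>With \<open>a = 1/l\<close>, the powers of \<beta> in the numerator combine to
  \<open>\<beta> powr (1 - a)\<close>, which matches \<open>u ^ (l - 1)\<close>. The only loss is
  bounding \<open>1 - \<beta> - x * \<beta>\<close> by \<open>1 - \<beta>\<close> in the
  denominator.\<close>

lemma t_beta_scaled_ge:
  fixes \<beta> u x :: real
  assumes l: "l \<ge> 2" and \<beta>: "0 < \<beta>" "\<beta> < 1/2" and u: "0 < u" "u ^ l = \<beta> / (1 - \<beta>)"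
    and x: "0 < x" "x < 1"
  shows "(1 - x) powr (1 / real l) * x powr (1 - 2 / real l) * u ^ (l - 1)
           \<le> t_beta l \<beta> (x * \<beta>)"
proof -
  define a where "a = 1 / real l"
  have a: "a > 0" "(real l - 1) / real l = 1 - a" "2 / real l = 2 * a" "real l * a = 1" "a \<le> 1"
    using l by (auto simp: a_def field_simps)
  have x\<beta>: "x * \<beta> < \<beta>" "x * \<beta> > 0" using x \<beta> by auto
  have exponent: "real (l - 1) = real l * (1 - a)" using l a by (simp add: algebra_simps)
  have "u ^ (l - 1) = u powr real (l - 1)" using u(1) by (simp add: powr_realpow)
  also have "\<dots> = (u powr real l) powr (1 - a)" by (simp only: exponent powr_powr)
  also have "\<dots> = (u ^ l) powr (1 - a)" using u(1) by (simp add: powr_realpow)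
  also have "\<dots> = \<beta> powr (1 - a) / (1 - \<beta>) powr (1 - a)"
    using u \<beta> by (simp add: powr_divide)
  finally have eq: "u ^ (l - 1) = \<beta> powr (1 - a) / (1 - \<beta>) powr (1 - a)" .
  have "\<beta> - x * \<beta> = (1 - x) * \<beta>" by (simp add: algebra_simps)
  then have num: "(\<beta> - x * \<beta>) powr a * (x * \<beta>) powr (1 - 2 * a)
      = (1 - x) powr a * x powr (1 - 2 * a) * \<beta> powr (1 - a)"
    using x \<beta> by (simp add: powr_mult flip: powr_add)
  have "(1 - \<beta> - x * \<beta>) powr (1 - a) \<le> (1 - \<beta>) powr (1 - a)"
    using a \<beta> x\<beta> by (intro powr_mono2) auto
  then show ?thesis
    unfolding t_beta_def a a_def[symmetric] num eq
    using \<beta> x\<beta> by (auto simp: intro!: divide_left_mono mult_pos_pos)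
qed

text \<open>\<open>c0 l \<beta>\<close> is the positive root in \<open>y\<close> of the quadratic in \<open>q\<close>.\<close>

lemma c0_less:
  fixes \<beta> y :: real
  assumes l: "l \<ge> 2" and \<beta>: "0 < \<beta>" "\<beta> < 1/2" and y: "0 \<le> y"
    and q: "real l * y\<^sup>2 + (2 * real l - 1 - 3 * \<beta> * real l) * y > \<beta> * (1 - 2 * \<beta>)"
  shows "c0 l \<beta> < y"
proof -
  define L where "L = real l"
  have L: "L \<ge> 2" using l by (simp add: L_def)
  define r where "r = 2 * L * y + 2 * L - 1 - 3 * \<beta> * L"
  define S where "S = sqrt (9 * \<beta>^2 * L^2 - 8 * \<beta>^2 * L - 12 * \<beta> * L^2 + 10 * \<beta> * L + 4 * L^2 - 4 * L + 1)"
  have "S < \<bar>r\<bar>"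
    unfolding S_def
  proof (rule real_less_lsqrt)
    \<comment> \<open>This product equals \<open>r\<^sup>2\<close> minus the radicand of
      \<open>S\<close>, by completing the square.\<close>
    have "4 * L * (L * y\<^sup>2 + (2 * L - 1 - 3 * \<beta> * L) * y - \<beta> * (1 - 2 * \<beta>)) > 0"
      using q L by (simp add: L_def)
    then show "9 * \<beta>^2 * L^2 - 8 * \<beta>^2 * L - 12 * \<beta> * L^2 + 10 * \<beta> * L + 4 * L^2 - 4 * L + 1 < \<bar>r\<bar>\<^sup>2"
      unfolding r_def power2_abs by (simp add: power2_eq_square algebra_simps)
  qed auto
  moreover have "r \<ge> 0"
  proof -
    have "3 * \<beta> * L \<le> 3/2 * L" using \<beta> L by (intro mult_right_mono) auto
    moreover have "2 * L * y \<ge> 0" using L y by simp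
    ultimately show ?thesis using L unfolding r_def by linarith
  qed
  ultimately have "3 * \<beta> * L - 2 * L + 1 + S < y * (2 * L)"
    by (simp add: r_def mult_ac)
  then show ?thesis
    using L unfolding c0_def Let_def L_def[symmetric] S_def[symmetric]
    by (simp only: pos_divide_less_eq)
qed

section \<open>The equation for \<beta> in terms of \<open>u\<close>, and the resulting
  bounds\<close>

locale beta_star_scaled =
  fixes d l :: nat and \<beta> u :: real
  assumes d: "d \<ge> 2" and l: "l \<ge> 2"
    and \<beta>: "0 < \<beta>" "real d * \<beta> < 1"
    and u: "0 < u" "u < 1" "1 - real d * \<beta> = u * (1 - \<beta>)"
    and u_power: "u ^ l = \<beta> / (1 - \<beta>)"
begin

lemma \<beta>_less_half: "\<beta> < 1/2"
proof -
  have "2 * \<beta> \<le> real d * \<beta>" using d \<beta>(1) by (intro mult_right_mono) auto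
  then show ?thesis using \<beta>(2) by simp
qed

lemma d_minus_1_mult_power: "(real d - 1) * u ^ l = 1 - u"
  using u(3) \<beta>_less_half unfolding u_power by (simp add: field_simps)

lemma d_minus_1_mult_t_beta_ge:
  assumes "0 < x" "x < 1"
  shows "(1 - x) powr (1 / real l) * x powr (1 - 2 / real l) * (1 - u) / u
           \<le> (real d - 1) * t_beta l \<beta> (x * \<beta>)"
proof -
  have "u ^ l = u * u ^ (l - 1)" using l by (cases l) auto
  then have u_quot: "(1 - u) / u = (real d - 1) * u ^ (l - 1)"
    using u(1) by (simp flip: d_minus_1_mult_power)
  have "(1 - x) powr (1 / real l) * x powr (1 - 2 / real l) * (1 - u) / u
      = (real d - 1) * ((1 - x) powr (1 / real l) * x powr (1 - 2 / real l) * u ^ (l - 1))"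
    unfolding times_divide_eq_right[symmetric] u_quot by (simp only: mult_ac)
  also have "\<dots> \<le> (real d - 1) * t_beta l \<beta> (x * \<beta>)"
    using d by (intro mult_left_mono t_beta_scaled_ge l \<beta>(1) \<beta>_less_half u(1) u_power assms) simp
  finally show ?thesis .
qed

text \<open>Terms of favourable sign are dropped from the rescaled \<open>G_beta\<close>.
  Quantifying over every \<open>T\<close> above the lower bound avoids the exact value of
  \<open>t_beta\<close>.\<close>

lemma G_beta_neg_of_bound:
  assumes x: "0 < x" "x < 1"
    and neg: "\<And>T. T \<ge> (1 - x) powr (1 / real l) * x powr (1 - 2 / real l) * (1 - u) / u \<Longrightarrow>
      (real l - 1) * (1 - x) * (1 - \<beta>) * ((1 - u) * x - T * (2 * u * (1 - \<beta>) + (1 - u) * x))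
      + T * x + 2 * u + \<beta> * x\<^sup>2 < 0"
  shows "G_beta d l \<beta> (x * \<beta>) < 0"
proof -
  define T where "T = (real d - 1) * t_beta l \<beta> (x * \<beta>)"
  have T: "T \<ge> (1 - x) powr (1 / real l) * x powr (1 - 2 / real l) * (1 - u) / u"
    unfolding T_def by (rule d_minus_1_mult_t_beta_ge[OF x])
  then have "T \<ge> 0" using x u by (smt (verit) divide_nonneg_pos mult_nonneg_nonneg powr_ge_zero)
  have "2 * u * (1 - \<beta>)\<^sup>2 \<le> 2 * u"
    using u \<beta> \<beta>_less_half by (simp add: power_le_one)
  \<comment> \<open>Since \<open>d * \<beta> < 1\<close>, the part of the coefficient of
    \<open>x\<close> without \<open>T\<close> is at most \<open>\<beta> - 1 < 0\<close>.\<close>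
  moreover have "\<beta> * (real d * \<beta>) \<le> \<beta>" using \<beta> by simp
  then have "x * (2 * \<beta> * (real d * \<beta>) - 1 - \<beta>) \<le> 0"
    using x \<beta>_less_half by (intro mult_nonneg_nonpos) linarith+
  moreover have "\<beta> * T * x\<^sup>2 \<ge> 0" "x * T * \<beta> \<ge> 0" using \<beta> \<open>T \<ge> 0\<close> x by auto
  ultimately have "(real l - 1) * (1 - x) * (1 - \<beta>) * ((1 - u) * x - T * (2 * u * (1 - \<beta>) + (1 - u) * x))
      + \<beta> * (1 - T) * x\<^sup>2 + 2 * u * (1 - \<beta>)\<^sup>2
      + x * (T * (1 - \<beta>) - 1 - \<beta> + 2 * \<beta> * (real d * \<beta>)) < 0"
    using neg[OF T] by (simp add: algebra_simps)
  then show ?thesis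
    unfolding G_beta_scaled[OF u(3) T_def[symmetric]] using \<beta>(1) by (rule mult_pos_neg[rotated])
qed

section \<open>Points where \<open>G_beta\<close> is negative, and their admissibility\<close>

text \<open>The first alternative serves large \<open>l\<close>, the second bounded \<open>l\<close>
  with large \<open>d\<close>, where \<open>u\<close> is tiny and \<open>T\<close> is large.\<close>

lemma G_beta_quarter_neg:
  assumes l3: "l \<ge> 3" and \<beta>9: "\<beta> \<le> 1/9"
    and cases: "(real l - 1) * (1 - u) \<ge> 36 \<or> (real l - 1) * (1 - u) \<ge> 7/4 \<and> 1 - u \<ge> 288 * u"
  shows "G_beta d l \<beta> (1/4 * \<beta>) < 0"
proof (rule G_beta_neg_of_bound)
  fix T
  assume "T \<ge> (1 - 1/4) powr (1 / real l) * (1/4) powr (1 - 2 / real l) * (1 - u) / u"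
  \<comment> \<open>Uniform in \<open>l\<close>: 3/4 exceeds 1/16, the square of 1/4, so the first
    factor is at least \<open>(1/4) powr (2/l)\<close> and the exponents add up to 1.\<close>
  also have "(1 - 1/4) powr (1 / real l) * (1/4) powr (1 - 2 / real l) \<ge> (1/4 :: real)"
  proof -
    have "(1/4 :: real) = (1/4) powr (2 / real l) * (1/4) powr (1 - 2 / real l)"
      by (simp flip: powr_add)
    also have "(1/4 :: real) powr (2 / real l) = ((1/4) powr 2) powr (1 / real l)"
      by (simp only: powr_powr) simp
    also have "\<dots> \<le> (1 - 1/4) powr (1 / real l)"
      by (intro powr_mono2) (auto simp: power2_eq_square)
    finally show ?thesis by (simp add: mult_right_mono)
  qed
  then have "1/4 * (1 - u) / u \<le> (1 - 1/4) powr (1 / real l) * (1/4) powr (1 - 2 / real l) * (1 - u) / u"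
    using u by (intro divide_right_mono mult_right_mono) auto
  finally have T: "(1 - u) / (4 * u) \<le> T" by simp
  then have Tu: "1 - u \<le> 4 * (T * u)" using u by (simp add: field_simps)
  have "T \<ge> 0" using T u by (smt (verit) divide_nonneg_pos)
  define W where "W = (real l - 1) * (1 - u)"
  have "W \<ge> 0" using l u by (simp add: W_def)
  define P where "P = T * u * (1 - \<beta>)"
  define Q where "Q = (1 - u) * T"
  have "(1 - u) / 4 * (8/9) \<le> P"
    unfolding P_def using Tu \<beta>9 u by (intro mult_mono) auto
  then have P: "2 * (1 - u) \<le> 9 * P" by simp
  have lhs: "(1 - u) * (1/4) - T * (2 * u * (1 - \<beta>) + (1 - u) * (1/4)) = (1 - u) / 4 - 2 * P - Q / 4"
    and rhs: "- ((1 - u) * (1/8 + T / 4)) = - ((1 - u) / 8) - Q / 4"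
    by (simp_all add: P_def Q_def algebra_simps)
  \<comment> \<open>By the bound on \<open>P\<close>, the terms without \<open>Q\<close> are at most
    (1/4 - 4/9)(1 - u) = -7/36 (1 - u), below -(1 - u)/8.\<close>
  have "(1 - u) * (1/4) - T * (2 * u * (1 - \<beta>) + (1 - u) * (1/4)) \<le> - ((1 - u) * (1/8 + T / 4))"
    unfolding lhs rhs using P u(2) by (simp add: field_simps)
  then have "(real l - 1) * (1 - 1/4) * (1 - \<beta>) *
        ((1 - u) * (1/4) - T * (2 * u * (1 - \<beta>) + (1 - u) * (1/4)))
      \<le> (real l - 1) * (1 - 1/4) * (1 - \<beta>) * - ((1 - u) * (1/8 + T / 4))"
    using l \<beta>9 by (intro mult_left_mono) auto
  also have "\<dots> = - ((1 - 1/4) * (1 - \<beta>) * (W * (1/8 + T / 4)))"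
    by (simp only: W_def mult_minus_right mult_ac)
  also have "\<dots> \<le> - (2/3 * (W * (1/8 + T / 4)))"
    using \<beta>9 \<open>W \<ge> 0\<close> \<open>T \<ge> 0\<close> by (intro le_imp_neg_le mult_right_mono) auto
  finally have main: "(real l - 1) * (1 - 1/4) * (1 - \<beta>) *
        ((1 - u) * (1/4) - T * (2 * u * (1 - \<beta>) + (1 - u) * (1/4))) \<le> - (W / 12) - W * T / 6"
    by (simp add: algebra_simps)
  define R where "R = W * T"
  \<comment> \<open>If \<open>W\<close> is at least 36, then \<open>W / 12\<close> is at least 3 and
    beats \<open>2 * u + \<beta> / 16\<close>, while \<open>R / 6\<close> beats
    \<open>T / 4\<close>. Otherwise \<open>R / 6 - T / 4\<close> is at least \<open>T / 24\<close>,
    hence at least 3 once \<open>T\<close> is at least 72; this is the source of 288 = 4 *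
    72.\<close>
  have "- (W / 12) - R / 6 + T * (1/4) + 2 * u + \<beta> * (1/4)\<^sup>2 < 0"
    using cases unfolding W_def[symmetric]
  proof
    assume "W \<ge> 36"
    then have "R \<ge> 36 * T" unfolding R_def using \<open>T \<ge> 0\<close> by (intro mult_right_mono)
    then show ?thesis using \<open>W \<ge> 36\<close> \<open>T \<ge> 0\<close> u \<beta>9 by (simp add: power2_eq_square)
  next
    assume *: "W \<ge> 7/4 \<and> 1 - u \<ge> 288 * u"
    then have "R \<ge> 7/4 * T" unfolding R_def using \<open>T \<ge> 0\<close> by (intro mult_right_mono) auto
    moreover have "72 * u \<le> T * u" using * Tu by linarith
    then have "T \<ge> 72" using u(1) by simp
    ultimately show ?thesis using * u \<beta>9 by (simp add: power2_eq_square)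
  qed
  then show "(real l - 1) * (1 - 1/4) * (1 - \<beta>) *
        ((1 - u) * (1/4) - T * (2 * u * (1 - \<beta>) + (1 - u) * (1/4)))
      + T * (1/4) + 2 * u + \<beta> * (1/4)\<^sup>2 < 0"
    using main unfolding R_def by linarith
qed auto

text \<open>For \<open>l = 2\<close> the terms in \<open>T * x\<close> nearly cancel, leaving about
  \<open>T * x\<^sup>2\<close>, which is unbounded at fixed \<open>x\<close>. Taking
  \<open>x = u / 4\<close> makes \<open>T * x\<close> equal to \<open>T * u / 4\<close>, which the
  term \<open>-2 * T * u\<close> outweighs.\<close>

lemma G_beta_2_neg:
  assumes l2: "l = 2" and \<beta>9: "\<beta> \<le> 1/9" and u_small: "u \<le> 1/1000"
  shows "G_beta d l \<beta> (u / 4 * \<beta>) < 0"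
proof (rule G_beta_neg_of_bound)
  fix T
  define x where "x = u / 4"
  have x: "0 < x" "x \<le> 1/4000" "u = 4 * x" using u u_small by (auto simp: x_def)
  assume "T \<ge> (1 - u / 4) powr (1 / real l) * (u / 4) powr (1 - 2 / real l) * (1 - u) / u"
  moreover have "(1 - x) powr 1 \<le> (1 - x) powr (1/2)"
    using x by (intro powr_mono') auto
  ultimately have "T \<ge> (1 - x) powr (1/2) * (1 - u) / u" "1 - x \<le> (1 - x) powr (1/2)"
    using l2 x by (auto simp flip: x_def)
  moreover have "(1 - x) * (1 - u) / u \<le> (1 - x) powr (1/2) * (1 - u) / u"
    using calculation u by (intro divide_right_mono mult_right_mono) auto
  ultimately have "(1 - x) * (1 - u) / u \<le> T" by linarith
  then have T: "(1 - x) * (1 - u) \<le> T * u" using u by (simp add: pos_divide_le_eq)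
  have "(1 - x) * (1 - u) \<ge> (1 - 1/4000) * (1 - 1/1000)"
    using x u_small by (intro mult_mono) auto
  with T have Tu: "T * u \<ge> 9/10" by simp
  then have "0 < T * u" by linarith
  then have "T \<ge> 0" using u(1) zero_less_mult_pos2 less_imp_le by blast
  have "T * (2 * u * (1 - \<beta>) + (1 - u) * x) \<ge> T * (2 * u * (8/9))"
    using \<open>T \<ge> 0\<close> \<beta>9 u x by (intro mult_left_mono add_increasing2 mult_left_mono) auto
  moreover have "(1 - u) * x \<le> 1 * x" using u x by (intro mult_right_mono) auto
  ultimately have br: "(1 - u) * x - T * (2 * u * (1 - \<beta>) + (1 - u) * x) \<le> x - 16/9 * (T * u)"
    by simp
  have "(1 - x) * (1 - \<beta>) \<ge> (1 - 1/4000) * (8/9)"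
    using x \<beta>9 by (intro mult_mono) auto
  then have f: "(1 - x) * (1 - \<beta>) \<ge> 8/10" by simp
  have "(1 - x) * (1 - \<beta>) * ((1 - u) * x - T * (2 * u * (1 - \<beta>) + (1 - u) * x))
      \<le> (1 - x) * (1 - \<beta>) * (x - 16/9 * (T * u))"
    using br x \<beta>9 by (intro mult_left_mono) auto
  \<comment> \<open>The second factor is negative, so a lower bound for the first gives an upper
    bound for the product.\<close>
  also have "\<dots> \<le> 8/10 * (x - 16/9 * (T * u))"
    by (rule mult_right_mono_neg[OF f]) (use Tu x(2) in linarith)
  finally have main: "(1 - x) * (1 - \<beta>) * ((1 - u) * x - T * (2 * u * (1 - \<beta>) + (1 - u) * x))
      \<le> 8/10 * (x - 16/9 * (T * u))" .
  have Tx: "T * x = T * u / 4" by (simp add: x_def)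
  have "\<beta> * x\<^sup>2 \<le> 1/9 * 1" using \<beta>9 \<beta> x by (intro mult_mono power_le_one) auto
  then have "8/10 * (x - 16/9 * (T * u)) + T * x + 2 * u + \<beta> * x\<^sup>2 < 0"
    unfolding Tx using Tu x(2) u_small by (simp add: field_simps)
  then have "(1 - x) * (1 - \<beta>) * ((1 - u) * x - T * (2 * u * (1 - \<beta>) + (1 - u) * x))
      + T * x + 2 * u + \<beta> * x\<^sup>2 < 0"
    using main by (elim le_less_trans[rotated]) simp
  then show "(real l - 1) * (1 - u / 4) * (1 - \<beta>) *
      ((1 - u) * (u / 4) - T * (2 * u * (1 - \<beta>) + (1 - u) * (u / 4)))
      + T * (u / 4) + 2 * u + \<beta> * (u / 4)\<^sup>2 < 0"
    by (simp only: l2 x_def of_nat_numeral) simp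
qed (use u in auto)

text \<open>It suffices that \<open>c0\<close> lies below \<open>3/4 * \<beta>\<close>. Evaluating
  its quadratic there and dividing by \<beta> gives the linear inequality
  \<open>bound\<close>.\<close>

lemma c0_less_scaled:
  assumes x: "0 < x" "x \<le> 1/4" and small: "l = 2 \<Longrightarrow> \<beta> \<le> 1/9"
  shows "x * \<beta> < \<beta> - c0 l \<beta>"
proof -
  have bound: "\<beta> * (27/16 * real l - 2) < 3/4 * (2 * real l - 1) - 1"
  proof (cases "l = 2")
    case True
    then show ?thesis using small by simp
  next
    case False
    then have "l \<ge> 3" using l by simp
    then have l3: "real l \<ge> 3" by simp
    then have "\<beta> * (27/16 * real l - 2) \<le> 1/2 * (27/16 * real l - 2)"
      using \<beta>_less_half by (intro mult_right_mono) auto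
    also have "\<dots> < 3/4 * (2 * real l - 1) - 1" using l3 by simp
    finally show ?thesis .
  qed
  have "c0 l \<beta> < 3/4 * \<beta>"
  proof (rule c0_less[OF l \<beta>(1) \<beta>_less_half])
    from bound have "\<beta> * (\<beta> * (27/16 * real l - 2)) < \<beta> * (3/4 * (2 * real l - 1) - 1)"
      using \<beta>(1) by (rule mult_strict_left_mono)
    then show "real l * (3/4 * \<beta>)\<^sup>2 + (2 * real l - 1 - 3 * \<beta> * real l) * (3/4 * \<beta>) > \<beta> * (1 - 2 * \<beta>)"
      by (simp add: power2_eq_square field_simps)
  qed (use \<beta> in auto)
  moreover have "x * \<beta> \<le> 1/4 * \<beta>" using x \<beta>(1) by (intro mult_right_mono) auto
  ultimately show ?thesis by simp
qed

end

section \<open>Uniformity in \<open>d\<close> and \<open>l\<close>, and finiteness\<close>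

lemma beta_star_scaled_exists:
  assumes "d \<ge> 2" "l \<ge> 2"
  obtains u where "beta_star_scaled d l (beta_star d l) u"
proof -
  define \<beta> where "\<beta> = beta_star d l"
  have b: "0 < \<beta>" "\<beta> < 1 / real d" "(1 - real d * \<beta>) ^ l = \<beta> * (1 - \<beta>) ^ (l - 1)"
    using is_beta_star_beta_star[OF assms] unfolding is_beta_star_def \<beta>_def by auto
  have d\<beta>: "real d * \<beta> < 1" using b assms by (simp add: field_simps)
  have "2 * \<beta> \<le> real d * \<beta>" using assms b by (intro mult_right_mono) auto
  then have \<beta>1: "\<beta> < 1" "\<beta> < real d * \<beta>" using b d\<beta> by linarith+
  have "(1 - \<beta>) ^ l = (1 - \<beta>) * (1 - \<beta>) ^ (l - 1)" using assms by (cases l) auto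
  moreover define u where "u = (1 - real d * \<beta>) / (1 - \<beta>)"
  ultimately have "u ^ l = \<beta> / (1 - \<beta>)"
    using \<beta>1 by (simp add: power_divide b(3))
  moreover have "0 < u" "u < 1"
    unfolding u_def using d\<beta> \<beta>1 by (simp_all only: divide_less_eq_1_pos diff_gt_0_iff_gt divide_pos_pos)
  moreover have "1 - real d * \<beta> = u * (1 - \<beta>)" using \<beta>1 by (simp add: u_def)
  ultimately have "beta_star_scaled d l \<beta> u"
    using assms b(1) d\<beta> by unfold_locales
  then show ?thesis using that unfolding \<beta>_def by blast
qed

text \<open>The power on the right tends to exp(-36) > 0 while \<open>36 / (l - 1)\<close> tends to
  0. This will force \<open>(l - 1) * (1 - u)\<close> to be at least 36; \<open>l \<ge> 38\<close>
  keeps the base positive.\<close>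

lemma large_l_bounds:
  "\<forall>\<^sub>F l in sequentially. (8/9::real) ^ l < 1/9 \<and>
     36 / (real l - 1) < (1 - 36 / (real l - 1)) ^ l \<and> l \<ge> (38::nat)"
  by (intro eventually_conj; real_asymp)

theorem propositionA1:
  shows "finite {(d :: nat, l :: nat). 2 \<le> d \<and> 2 \<le> l \<and>
           (\<forall>s :: real. 0 < s \<and> s < beta_star d l - c0 l (beta_star d l) \<longrightarrow>
              G_beta d l (beta_star d l) s > 0)}"
proof -
  obtain N :: nat where N: "\<And>l. l \<ge> N \<Longrightarrow> (8/9::real) ^ l < 1/9 \<and>
     36 / (real l - 1) < (1 - 36 / (real l - 1)) ^ l \<and> l \<ge> 38"
    using large_l_bounds unfolding eventually_sequentially by blast
  \<comment> \<open>Outside a finite box of pairs the condition fails at an explicit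
    \<open>s = x * \<beta>\<close>.\<close>
  have "\<exists>s. 0 < s \<and> s < beta_star d l - c0 l (beta_star d l) \<and> \<not> G_beta d l (beta_star d l) s > 0"
    if dl: "2 \<le> d" "2 \<le> l" and large: "l \<ge> N \<or> d > 1000 ^ N + 10" for d l
  proof -
    define \<beta> where "\<beta> = beta_star d l"
    obtain u where "beta_star_scaled d l \<beta> u"
      using beta_star_scaled_exists[OF dl] unfolding \<beta>_def .
    then interpret beta_star_scaled d l \<beta> u .
    have "\<exists>x. 0 < x \<and> x \<le> 1/4 \<and> (l = 2 \<longrightarrow> \<beta> \<le> 1/9) \<and> G_beta d l \<beta> (x * \<beta>) < 0"
    proof (cases "l \<ge> N")
      case True
      note N = N[OF True]
      have "1 * u ^ l \<le> (real d - 1) * u ^ l" using d u by (intro mult_right_mono) auto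
      then have ul: "u ^ l \<le> 1 - u" by (simp add: d_minus_1_mult_power)
      have "\<beta> * 1 \<le> \<beta> / (1 - \<beta>)"
        using \<beta>(1) \<beta>_less_half by (simp add: field_simps)
      then have "\<beta> \<le> u ^ l" by (simp add: u_power)
      \<comment> \<open>Either \<open>u\<close> is at most 8/9 and its power is small, or
        \<open>1 - u < 1/9\<close> already bounds \<open>u ^ l\<close>.\<close>
      moreover have "u ^ l \<le> 1/9"
      proof (cases "u \<le> 8/9")
        case True
        then have "u ^ l \<le> (8/9) ^ l" using u by (intro power_mono) auto
        then show ?thesis using N by linarith
      qed (use ul in linarith)
      ultimately have "\<beta> \<le> 1/9" by linarith
      moreover have "(real l - 1) * (1 - u) \<ge> 36"
      proof (rule ccontr)
        assume "\<not> ?thesis"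
        then have *: "1 - u < 36 / (real l - 1)" using N by (simp add: field_simps)
        \<comment> \<open>Otherwise \<open>u ^ l\<close> would exceed \<open>36 / (l - 1)\<close>,
          hence \<open>1 - u\<close>.\<close>
        have "(1 - 36 / (real l - 1)) ^ l \<le> u ^ l"
          using * N by (intro power_mono) (auto simp: field_simps)
        then show False using * N ul by linarith
      qed
      ultimately show ?thesis
        using G_beta_quarter_neg N by (intro exI[of _ "1/4"]) auto
    next
      case False
      with large have d_large: "d > 1000 ^ N + 10" by blast
      have "9 * \<beta> \<le> real d * \<beta>" using d_large \<beta>(1) by (intro mult_right_mono) auto
      then have \<beta>9: "\<beta> \<le> 1/9" using \<beta> by linarith
      \<comment> \<open>As \<open>l < N\<close>, a larger \<open>u\<close> would make
        \<open>(d - 1) * u ^ l\<close> at least 1, although it equals \<open>1 - u\<close>.\<close>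
      have u_small: "u \<le> 1/1000"
      proof (rule ccontr)
        assume "\<not> ?thesis"
        then have "(1/1000) ^ l \<le> u ^ l" by (intro power_mono) auto
        moreover have "(1/1000 :: real) ^ N \<le> (1/1000) ^ l"
          using False by (intro power_decreasing) auto
        ultimately have "(1/1000) ^ N \<le> u ^ l" by linarith
        moreover have "real (1000 ^ N + 10) < real d" using d_large by (simp only: of_nat_less_iff)
        then have "1000 ^ N \<le> real d - 1" by simp
        ultimately have "(1000 ^ N) * (1/1000) ^ N \<le> (real d - 1) * u ^ l"
          using d by (intro mult_mono) auto
        then show False unfolding d_minus_1_mult_power using u by (simp add: power_divide)
      qed
      show ?thesis
      proof (cases "l = 2")
        case True
        then show ?thesis
          using G_beta_2_neg \<beta>9 u u_small by (intro exI[of _ "u / 4"]) auto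
      next
        case False
        then have "l \<ge> 3" using l by simp
        moreover have "(real l - 1) * (1 - u) \<ge> 2 * (999/1000)"
          using \<open>l \<ge> 3\<close> u_small by (intro mult_mono) auto
        ultimately show ?thesis
          using G_beta_quarter_neg \<beta>9 u_small by (intro exI[of _ "1/4"]) auto
      qed
    qed
    then obtain x where x: "0 < x" "x \<le> 1/4" "l = 2 \<longrightarrow> \<beta> \<le> 1/9" "G_beta d l \<beta> (x * \<beta>) < 0" by blast
    then show ?thesis
      using c0_less_scaled[OF x(1,2)] \<beta>(1) unfolding \<beta>_def[symmetric]
      by (intro exI[of _ "x * \<beta>"]) auto
  qed
  then have "l < N \<and> d \<le> 1000 ^ N + 10"
    if "2 \<le> d" "2 \<le> l" "\<forall>s. 0 < s \<and> s < beta_star d l - c0 l (beta_star d l) \<longrightarrow>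
      G_beta d l (beta_star d l) s > 0" for d l
    using that by (meson not_less)
  then have "{(d, l). 2 \<le> d \<and> 2 \<le> l \<and>
           (\<forall>s. 0 < s \<and> s < beta_star d l - c0 l (beta_star d l) \<longrightarrow> G_beta d l (beta_star d l) s > 0)}
      \<subseteq> {..1000 ^ N + 10} \<times> {..<N}"
    by blast
  then show ?thesis by (rule finite_subset) simp
qed

end
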